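(* For all but an $\exp(-\Theta(n))$-fraction of demand profiles $D \in \mathcal{D}_1(n,d)$, \[p_*(D) = \Omega\Big(\min\Big(1,\frac{nd}{m}\Big)\Big).\]
   Context: Fix $m\in\mathbb N$ and the universe of IDs $[m]=\{1,\dots,m\}$. An ID-generation algorithm $\mathcal A$ is a probability distribution over permutations of $[m]$: an instance draws a permutation and answers its $t$-th request with the $t$-th entry. A demand profile $D=(d_1,\dots,d_n)\in[m]^n$ means $n$ instances of $\mathcal A$ with independent randomness, instance $i$ receiving $d_i$ requests one at a time (without knowing $d_i$ in advance). A collision occurs if the sets of IDs output by the instances are not pairwise disjoint; $p_{\mathcal A}(D)$ is the collision probability, and $p_*(D)=\min_{\mathcal A}p_{\mathcal A}(D)$ over all ID-generation algorithms. $\mathcal D_1(n,d)=\{D\in[m]^n : \sum_i d_i = d\}$. Asymptotic notation is non-asymptotic: constants hidden in $\Omega,\Theta$ are absolute, independent of $m,n,d$.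
   Formalization: The formal statement assumes n ≥ 2: for n = 1 a single instance never collides, so p_*(D) = 0 for the only profile D = (d) with 1 ≤ d ≤ m, and the claim with absolute constants fails. *)

theory Defs
  imports "HOL-Probability.Probability" "HOL-Combinatorics.Permutations"
begin

text \<open>
  An instance with drawn permutation \<open>\<pi>\<close> of \<open>{1..m}\<close> answers its \<open>t\<close>-th request
  (counting from 1) with \<open>\<pi> t\<close>; after \<open>k\<close> requests it has output \<open>\<pi> ` {1..k}\<close>.
\<close>

definition id_algorithms :: "nat \<Rightarrow> (nat \<Rightarrow> nat) pmf set" where
  "id_algorithms m = {A. set_pmf A \<subseteq> {\<pi>. \<pi> permutes {1..m}}}"

text \<open>
  Demand profiles are lists; the instances are numbered by the list positions, from 0.
\<close>

definition collision :: "nat list \<Rightarrow> (nat \<Rightarrow> nat \<Rightarrow> nat) \<Rightarrow> bool" where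
  "collision D \<pi> \<longleftrightarrow> \<not> disjoint_family_on (\<lambda>i. \<pi> i ` {1..D ! i}) {..<length D}"

text \<open>
  The product distribution makes the instances independent copies of \<open>A\<close>; the second
  argument of \<open>Pi_pmf\<close> is only the dummy value outside the index set.
\<close>

definition collision_prob :: "(nat \<Rightarrow> nat) pmf \<Rightarrow> nat list \<Rightarrow> real" where
  "collision_prob A D =
     measure_pmf.prob (Pi_pmf {..<length D} id (\<lambda>_. A)) {\<pi>. collision D \<pi>}"

text \<open>
  The infimum is a minimum: the collision probability is a polynomial, hence continuous,
  in the finitely many weights \<open>pmf A \<pi>\<close>, which range over a compact simplex.
\<close>

definition opt_collision_prob :: "nat \<Rightarrow> nat list \<Rightarrow> real" where
  "opt_collision_prob m D = (INF A \<in> id_algorithms m. collision_prob A D)"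

definition demand_profiles :: "nat \<Rightarrow> nat \<Rightarrow> nat \<Rightarrow> nat list set" where
  "demand_profiles m n d = {D. length D = n \<and> set D \<subseteq> {1..m} \<and> sum_list D = d}"

end

theory Submission
  imports Defs
begin

text \<open>
  Most compositions of \<open>d\<close> into \<open>n\<close> parts have more than \<open>n / 2\<close> parts of size at least
  \<open>h \<approx> d / (32 n)\<close>: forcing \<open>n / 2\<close> given parts to be smaller costs a factor \<open>16\<close> per part,
  which beats the \<open>2 ^ n\<close> choices of positions.

  For such a profile only the first \<open>h\<close> IDs of \<open>k \<ge> n / 2\<close> instances matter. They form
  independent random \<open>h\<close>-subsets of \<open>{1..m}\<close>. Some may be much more likely to be hit than
  others, so a plain second moment argument fails; instead the density \<open>p x = P (x \<in> S)\<close> is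
  truncated at \<open>q = h / m\<close>. If half of the sets are disjoint with union \<open>U\<close>, a fresh set meets
  \<open>U\<close> with probability at least \<open>(\<Sum>x\<in>U. min (p x) q) / h\<close>, which is a sum of independent
  terms in \<open>[0, q]\<close> with mean at least \<open>3 q / 4\<close>. Taking the Laplace transform, all sets are
  disjoint with probability at most \<open>exp (- \<Omega> (min k (k\<^sup>2 h / m)))\<close>.
\<close>

subsection \<open>Disjointness of independent random sets\<close>

lemma measure_pair_pmf:
  "measure_pmf.prob (pair_pmf X Y) E
     = measure_pmf.expectation X (\<lambda>x. measure_pmf.prob Y {y. (x, y) \<in> E})"
proof -
  have "ennreal (measure_pmf.prob (pair_pmf X Y) E) = (\<integral>\<^sup>+z. indicator E z \<partial>pair_pmf X Y)"
    by (simp add: measure_pmf.emeasure_eq_measure)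
  also have "\<dots> = (\<integral>\<^sup>+x. \<integral>\<^sup>+y. indicator {y. (x, y) \<in> E} y \<partial>Y \<partial>X)"
    by (subst nn_integral_pair_pmf') (intro nn_integral_cong, auto split: split_indicator)
  also have "\<dots> = (\<integral>\<^sup>+x. ennreal (measure_pmf.prob Y {y. (x, y) \<in> E}) \<partial>X)"
    by (simp add: measure_pmf.emeasure_eq_measure)
  also have "\<dots> = ennreal (measure_pmf.expectation X (\<lambda>x. measure_pmf.prob Y {y. (x, y) \<in> E}))"
    by (intro nn_integral_eq_integral measure_pmf.integrable_const_bound[where B = 1]) auto
  finally show ?thesis
    by (simp add: integral_nonneg_AE)
qed

text \<open>Linearity of expectation over the indicators of x \<in> S. Three weights matter below:
  the constant 1 gives the total density, the truncated density gives the mean of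
  \<open>truncated_hit\<close>, and the indicator of U gives the mean size of S \<inter> U.\<close>

lemma expectation_sum_over_random_set:
  fixes f :: "'a \<Rightarrow> real"
  assumes "finite M" "\<And>S. S \<in> set_pmf P \<Longrightarrow> S \<subseteq> M"
  shows "measure_pmf.expectation P (\<lambda>S. \<Sum>x\<in>S. f x)
           = (\<Sum>x\<in>M. f x * measure_pmf.prob P {S. x \<in> S})"
proof -
  have "measure_pmf.expectation P (\<lambda>S. \<Sum>x\<in>S. f x)
      = measure_pmf.expectation P (\<lambda>S. \<Sum>x\<in>M. f x * indicator {S. x \<in> S} S)"
  proof (intro integral_cong_AE)
    show "AE S in P. (\<Sum>x\<in>S. f x) = (\<Sum>x\<in>M. f x * indicator {S. x \<in> S} S)"
    proof (unfold AE_measure_pmf_iff, intro ballI)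
      fix S assume "S \<in> set_pmf P"
      then have "S \<subseteq> M" by (rule assms)
      then have "(\<Sum>x\<in>S. f x) = (\<Sum>x\<in>M. if x \<in> S then f x else 0)"
        using assms(1) by (simp add: sum.If_cases Int_absorb1)
      also have "\<dots> = (\<Sum>x\<in>M. f x * indicator {S. x \<in> S} S)"
        by (intro sum.cong) auto
      finally show "(\<Sum>x\<in>S. f x) = (\<Sum>x\<in>M. f x * indicator {S. x \<in> S} S)" .
    qed
  qed auto
  also have "\<dots> = (\<Sum>x\<in>M. f x * measure_pmf.prob P {S. x \<in> S})"
    by (subst Bochner_Integration.integral_sum)
       (auto intro!: integrable_mult_right integrable_real_indicator
             simp: measure_pmf.emeasure_eq_measure)
  finally show ?thesis .
qed

text \<open>Used twice: to replace a Laplace transform by a mean, and to turn a bound exp (- y) on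
  the probability of no collision into a collision probability of at least y / 2.\<close>

lemma exp_minus_le_linear:
  fixes y :: real
  assumes "0 \<le> y" "y \<le> 1"
  shows "exp (- y) \<le> 1 - y / 2"
proof -
  have "exp y \<ge> 1 + y" by simp
  moreover have "(1 - y / 2) * (1 + y) \<ge> 1"
  proof -
    have "y * y \<le> y * 1" using assms by (intro mult_left_mono) auto
    then show ?thesis by (simp add: algebra_simps)
  qed
  moreover have "(1 - y / 2) * exp y \<ge> (1 - y / 2) * (1 + y)"
    using assms by (intro mult_left_mono) auto
  ultimately have "(1 - y / 2) * exp y \<ge> 1" by linarith
  then have "1 - y / 2 \<ge> 1 / exp y" by (simp add: field_simps)
  then show ?thesis by (simp add: exp_minus inverse_eq_divide)
qed

text \<open>
  With \<open>q\<close> the mean density \<open>h / m\<close>, the truncation bounds this quantity by \<open>q\<close> while its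
  mean stays of order \<open>q\<close>.
\<close>

definition truncated_hit :: "'a set pmf \<Rightarrow> real \<Rightarrow> 'a set \<Rightarrow> real" where
  "truncated_hit P q S =
     (\<Sum>x\<in>S. min (measure_pmf.prob P {S'. x \<in> S'}) q) / real (card S)"

context
  fixes P :: "'a set pmf" and M :: "'a set" and h :: nat and q :: real
  assumes M: "finite M" "M \<noteq> {}"
    and supp: "\<And>S. S \<in> set_pmf P \<Longrightarrow> S \<subseteq> M \<and> card S = h"
    and h: "h > 0"
    and q: "q = real h / real (card M)"
begin

lemma truncated_hit_bounds:
  assumes "S \<in> set_pmf P"
  shows "0 \<le> truncated_hit P q S" "truncated_hit P q S \<le> q"
proof -
  have q0: "q \<ge> 0" using q by simp
  then show "0 \<le> truncated_hit P q S"
    by (auto simp: truncated_hit_def intro!: divide_nonneg_nonneg sum_nonneg)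
  have "(\<Sum>x\<in>S. min (measure_pmf.prob P {S'. x \<in> S'}) q) \<le> (\<Sum>x\<in>S. q)"
    by (intro sum_mono) auto
  then show "truncated_hit P q S \<le> q"
    using supp[OF assms] h by (simp add: truncated_hit_def field_simps)
qed

text \<open>The mean is the sum of \<open>min (p x) q * p x\<close> over M, divided by h. Each term
  is at least q * p x - q^2 / 4. As the densities sum to h = q * card M, the losses add up to a
  quarter of the main term q * h.\<close>

lemma expectation_truncated_hit: "measure_pmf.expectation P (truncated_hit P q) \<ge> 3 / 4 * q"
proof -
  define p where "p x = measure_pmf.prob P {S. x \<in> S}" for x
  have p_total: "(\<Sum>x\<in>M. p x) = real h"
  proof -
    have "(\<Sum>x\<in>M. p x) = measure_pmf.expectation P (\<lambda>S. \<Sum>x\<in>S. 1)"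
      using expectation_sum_over_random_set[OF M(1), of P "\<lambda>_. 1"] supp by (simp add: p_def)
    also have "\<dots> = measure_pmf.expectation P (\<lambda>S. real h)"
      using supp by (intro integral_cong_AE) (auto simp: AE_measure_pmf_iff)
    finally show ?thesis by simp
  qed
  have m: "real (card M) > 0" using M by (simp add: card_gt_0_iff)
  have "measure_pmf.expectation P (truncated_hit P q)
      = measure_pmf.expectation P (\<lambda>S. (\<Sum>x\<in>S. min (p x) q) / real h)"
    using supp by (intro integral_cong_AE) (auto simp: AE_measure_pmf_iff truncated_hit_def p_def)
  also have "\<dots> = (\<Sum>x\<in>M. min (p x) q * p x) / real h"
    using expectation_sum_over_random_set[OF M(1), of P "\<lambda>x. min (p x) q"] supp
    by (simp add: p_def)
  also have "\<dots> \<ge> (\<Sum>x\<in>M. q * p x - q\<^sup>2 / 4) / real h"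
  proof (intro divide_right_mono sum_mono)
    fix x
    \<comment> \<open>This square is for the points of density below q, where the term is p x * p x.
      At density q or more the term is q * p x, without loss.\<close>
    have "(p x - q / 2)\<^sup>2 \<ge> 0" by simp
    then have "p x * p x \<ge> q * p x - q\<^sup>2 / 4" by (simp add: power2_eq_square algebra_simps)
    then show "q * p x - q\<^sup>2 / 4 \<le> min (p x) q * p x" by (auto simp: min_def)
  qed simp
  also have "(\<Sum>x\<in>M. q * p x - q\<^sup>2 / 4) = q * real h - real (card M) * q * q / 4"
    using p_total by (simp add: sum_subtractf sum_distrib_left[symmetric] power2_eq_square)
  also have "\<dots> = q * real h * (3 / 4)"
    using m by (simp add: q)
  also have "\<dots> / real h = 3 / 4 * q"
    using h by simp
  finally show ?thesis .
qed

text \<open>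
  Markov's inequality for the size of the intersection with \<open>U\<close>, which is at most \<open>h\<close>.
\<close>

lemma prob_hit_ge:
  assumes "finite A" "disjoint_family_on F A" "\<And>i. i \<in> A \<Longrightarrow> F i \<in> set_pmf P"
  shows "measure_pmf.prob P {S. S \<inter> (\<Union>i\<in>A. F i) \<noteq> {}} \<ge> (\<Sum>i\<in>A. truncated_hit P q (F i))"
proof -
  define p where "p x = measure_pmf.prob P {S. x \<in> S}" for x
  define U where "U = (\<Union>i\<in>A. F i)"
  have UM: "U \<subseteq> M" using assms(3) supp by (auto simp: U_def)
  then have "finite U" using M(1) finite_subset by blast
  have "(\<Sum>i\<in>A. truncated_hit P q (F i)) = (\<Sum>i\<in>A. (\<Sum>x\<in>F i. min (p x) q)) / real h"
    using supp assms(3) by (simp add: truncated_hit_def p_def sum_divide_distrib)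
  also have "(\<Sum>i\<in>A. (\<Sum>x\<in>F i. min (p x) q)) = (\<Sum>x\<in>U. min (p x) q)"
    unfolding U_def
  proof (intro sum.UNION_disjoint[symmetric] ballI impI)
    show "finite (F i)" if "i \<in> A" for i
      using supp[OF assms(3)[OF that]] M(1) finite_subset by blast
  qed (use assms in \<open>auto simp: disjoint_family_on_def\<close>)
  also have "(\<Sum>x\<in>U. min (p x) q) \<le> (\<Sum>x\<in>U. p x)"
    by (intro sum_mono) auto
  also have "\<dots> = (\<Sum>x\<in>M. (if x \<in> U then 1 else 0) * p x)"
    using UM M(1) by (simp add: if_distrib[of "\<lambda>c. c * _"] sum.If_cases Int_absorb1 cong: if_cong)
  also have "\<dots> = measure_pmf.expectation P (\<lambda>S. \<Sum>x\<in>S. if x \<in> U then 1 else 0)"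
    using expectation_sum_over_random_set[OF M(1), of P "\<lambda>x. if x \<in> U then 1 else 0"] supp
    by (simp add: p_def)
  also have "\<dots> \<le> measure_pmf.expectation P (\<lambda>S. real h * indicator {S. S \<inter> U \<noteq> {}} S)"
  proof (intro integral_mono_AE)
    have fin: "finite (set_pmf P)"
      using supp M(1) by (intro finite_subset[of "set_pmf P" "Pow M"]) auto
    show "integrable P (\<lambda>S. \<Sum>x\<in>S. if x \<in> U then 1 else 0 :: real)"
         "integrable P (\<lambda>S. real h * indicator {S. S \<inter> U \<noteq> {}} S)"
      by (rule integrable_measure_pmf_finite[OF fin])+
    show "AE S in P. (\<Sum>x\<in>S. if x \<in> U then 1 else 0) \<le> real h * indicator {S. S \<inter> U \<noteq> {}} S"
    proof (unfold AE_measure_pmf_iff, intro ballI)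
      fix S assume S: "S \<in> set_pmf P"
      have "finite S" using supp[OF S] M(1) finite_subset by blast
      then have "(\<Sum>x\<in>S. if x \<in> U then 1 else 0 :: real) = real (card (S \<inter> U))"
        by (simp add: sum.If_cases)
      moreover have "card (S \<inter> U) \<le> h"
        using supp[OF S] \<open>finite S\<close> card_mono[of S "S \<inter> U"] by auto
      ultimately show "(\<Sum>x\<in>S. if x \<in> U then 1 else 0) \<le> real h * indicator {S. S \<inter> U \<noteq> {}} S"
        by (auto split: split_indicator)
    qed
  qed
  also have "\<dots> = real h * measure_pmf.prob P {S. S \<inter> U \<noteq> {}}"
    by simp
  finally show ?thesis
    using h by (simp add: U_def divide_right_mono field_simps)
qed

text \<open>The linear bound on exp needs an argument in [0, 1], and
  \<open>b * truncated_hit P q S\<close> may exceed 1. Hence b is first lowered to some \<beta> with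
  \<beta> * q \<le> 1. The factor 3 / 8 is 1 / 2 from the linear bound times 3 / 4 from the
  mean.\<close>

lemma expectation_exp_truncated_hit:
  assumes "0 \<le> b" "0 \<le> \<beta>" "\<beta> \<le> b" "\<beta> * q \<le> 1"
  shows "measure_pmf.expectation P (\<lambda>S. exp (- b * truncated_hit P q S)) \<le> exp (- 3 / 8 * \<beta> * q)"
proof -
  have fin: "finite (set_pmf P)"
    using supp M(1) by (intro finite_subset[of "set_pmf P" "Pow M"]) auto
  have "measure_pmf.expectation P (\<lambda>S. exp (- b * truncated_hit P q S))
      \<le> measure_pmf.expectation P (\<lambda>S. 1 - \<beta> / 2 * truncated_hit P q S)"
  proof (intro integral_mono_AE integrable_measure_pmf_finite[OF fin],
         unfold AE_measure_pmf_iff, intro ballI)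
    fix S assume S: "S \<in> set_pmf P"
    note g = truncated_hit_bounds[OF S]
    have "exp (- b * truncated_hit P q S) \<le> exp (- (\<beta> * truncated_hit P q S))"
      using g assms by (simp add: mult_right_mono)
    also have "\<dots> \<le> 1 - (\<beta> * truncated_hit P q S) / 2"
      using g assms mult_left_mono[OF g(2), of \<beta>] by (intro exp_minus_le_linear) auto
    finally show "exp (- b * truncated_hit P q S) \<le> 1 - \<beta> / 2 * truncated_hit P q S" by simp
  qed
  also have "\<dots> = 1 - \<beta> / 2 * measure_pmf.expectation P (truncated_hit P q)"
    by (simp add: integrable_measure_pmf_finite[OF fin])
  also have "\<dots> \<le> 1 - \<beta> / 2 * (3 / 4 * q)"
    using mult_left_mono[OF expectation_truncated_hit, of "\<beta> / 2"] assms by simp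
  also have "\<dots> \<le> exp (- 3 / 8 * \<beta> * q)"
    using exp_ge_add_one_self[of "- 3 / 8 * \<beta> * q"] by simp
  finally show ?thesis .
qed

text \<open>
  Reveal the sets indexed by \<open>A\<close> first. If they are pairwise disjoint, each set indexed by
  \<open>B\<close> independently has to miss their union.
\<close>

lemma prob_disjoint_family_le:
  fixes A B :: "'b set"
  assumes "finite A" "finite B" "A \<inter> B = {}" "0 \<le> \<beta>" "\<beta> \<le> real (card B)" "\<beta> * q \<le> 1"
  shows "measure_pmf.prob (Pi_pmf (A \<union> B) dflt (\<lambda>_. P)) {F. disjoint_family_on F (A \<union> B)}
           \<le> exp (- 3 / 8 * real (card A) * \<beta> * q)"
proof -
  have fin: "finite (set_pmf P)"
    using supp M(1) by (intro finite_subset[of "set_pmf P" "Pow M"]) auto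
  let ?b = "real (card B)"
  let ?g = "truncated_hit P q"
  define X where "X = Pi_pmf A dflt (\<lambda>_. P)"
  define Y where "Y = Pi_pmf B dflt (\<lambda>_. P)"
  \<comment> \<open>Disjointness within B is dropped, which leaves conditions on the sets
    \<open>G j\<close> that are independent once F is fixed.\<close>
  define E where "E = {(F :: 'b \<Rightarrow> 'a set, G :: 'b \<Rightarrow> 'a set).
    disjoint_family_on F A \<and> (\<forall>j\<in>B. G j \<inter> (\<Union>i\<in>A. F i) = {})}"
  have finX: "finite (set_pmf X)"
    unfolding X_def using assms(1) fin by (simp add: set_Pi_pmf finite_PiE_dflt)
  have "measure_pmf.prob (Pi_pmf (A \<union> B) dflt (\<lambda>_. P)) {F. disjoint_family_on F (A \<union> B)}
     = measure_pmf.prob (pair_pmf X Y)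
         {(F, G). disjoint_family_on (\<lambda>x. if x \<in> A then F x else G x) (A \<union> B)}"
    using assms by (simp add: Pi_pmf_union X_def Y_def vimage_def case_prod_unfold)
  also have "\<dots> \<le> measure_pmf.prob (pair_pmf X Y) E"
  proof -
    have "(F, G) \<in> E" if *: "disjoint_family_on (\<lambda>x. if x \<in> A then F x else G x) (A \<union> B)" for F G
    proof -
      have "F i \<inter> F j = {}" if "i \<in> A" "j \<in> A" "i \<noteq> j" for i j
        using disjoint_family_onD[OF *, of i j] that by simp
      moreover have "G j \<inter> F i = {}" if "i \<in> A" "j \<in> B" for i j
      proof -
        have "j \<notin> A" "j \<noteq> i" using that assms(3) by auto
        then show ?thesis using disjoint_family_onD[OF *, of j i] that by simp
      qed
      ultimately show ?thesis
        unfolding E_def disjoint_family_on_def mem_Collect_eq split by blast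
    qed
    then show ?thesis
      by (intro measure_pmf.finite_measure_mono) auto
  qed
  also have "\<dots> = measure_pmf.expectation X (\<lambda>F. measure_pmf.prob Y {G. (F, G) \<in> E})"
    by (rule measure_pair_pmf)
  also have "\<dots> \<le> measure_pmf.expectation X (\<lambda>F. \<Prod>i\<in>A. exp (- ?b * ?g (F i)))"
  proof (intro integral_mono_AE integrable_measure_pmf_finite[OF finX],
         unfold AE_measure_pmf_iff, intro ballI)
    fix F assume "F \<in> set_pmf X"
    then have F: "F i \<in> set_pmf P" if "i \<in> A" for i
      using that assms(1) by (auto simp: X_def set_Pi_pmf PiE_dflt_def)
    show "measure_pmf.prob Y {G. (F, G) \<in> E} \<le> (\<Prod>i\<in>A. exp (- ?b * ?g (F i)))"
    proof (cases "disjoint_family_on F A")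
      case True
      define U where "U = (\<Union>i\<in>A. F i)"
      have "measure_pmf.prob Y {G. (F, G) \<in> E}
          \<le> measure_pmf.prob Y (PiE_dflt B dflt (\<lambda>_. {S. S \<inter> U = {}}))"
        unfolding Y_def using True assms(2)
        by (intro measure_pmf.finite_measure_mono_AE)
           (auto simp: AE_measure_pmf_iff E_def U_def PiE_dflt_def set_Pi_pmf)
      also have "\<dots> = (measure_pmf.prob P {S. S \<inter> U = {}}) ^ card B"
        unfolding Y_def using assms(2) by (subst measure_Pi_pmf_PiE_dflt) auto
      also have "\<dots> \<le> (exp (- (\<Sum>i\<in>A. ?g (F i)))) ^ card B"
      proof (intro power_mono)
        have "measure_pmf.prob P {S. S \<inter> U = {}} = 1 - measure_pmf.prob P {S. S \<inter> U \<noteq> {}}"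
          using measure_pmf.prob_compl[of "{S. S \<inter> U \<noteq> {}}" P]
          by (simp add: set_diff_eq)
        also have "\<dots> \<le> 1 - (\<Sum>i\<in>A. ?g (F i))"
          using prob_hit_ge[OF assms(1) True F] by (simp add: U_def)
        also have "\<dots> \<le> exp (- (\<Sum>i\<in>A. ?g (F i)))"
          using exp_ge_add_one_self[of "- (\<Sum>i\<in>A. ?g (F i))"] by simp
        finally show "measure_pmf.prob P {S. S \<inter> U = {}} \<le> exp (- (\<Sum>i\<in>A. ?g (F i)))" .
      qed simp
      \<comment> \<open>The power over B becomes a factor in the exponent and the sum over A becomes
        a product, whose expectation factorises because the sets \<open>F i\<close> are
        independent.\<close>
      also have "\<dots> = (\<Prod>i\<in>A. exp (- ?b * ?g (F i)))"
        using assms(1)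
        by (simp add: exp_of_nat_mult[symmetric] exp_sum[symmetric] sum_distrib_left sum_negf)
      finally show ?thesis .
    next
      case False
      then have "{G. (F, G) \<in> E} = {}" by (auto simp: E_def)
      then show ?thesis by (simp add: prod_nonneg)
    qed
  qed
  also have "\<dots> = (measure_pmf.expectation P (\<lambda>S. exp (- ?b * ?g S))) ^ card A"
    unfolding X_def
    by (subst expectation_prod_Pi_pmf) (use assms(1) fin in \<open>auto intro!: integrable_measure_pmf_finite\<close>)
  also have "\<dots> \<le> (exp (- 3 / 8 * \<beta> * q)) ^ card A"
    using assms by (intro power_mono expectation_exp_truncated_hit integral_nonneg_AE) auto
  also have "\<dots> = exp (- 3 / 8 * real (card A) * \<beta> * q)"
    by (simp add: exp_of_nat_mult[symmetric] algebra_simps)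
  finally show ?thesis .
qed

end

subsection \<open>Lower bounds on collision probabilities\<close>

lemma no_collision_disjoint:
  assumes "\<not> collision D \<pi>" "J \<subseteq> {..<length D}" "\<And>i. i \<in> J \<Longrightarrow> h \<le> D ! i"
  shows "disjoint_family_on (\<lambda>i. \<pi> i ` {1..h}) J"
  unfolding disjoint_family_on_def
proof (intro ballI impI)
  fix i j assume ij: "i \<in> J" "j \<in> J" "i \<noteq> j"
  have sub: "\<pi> i ` {1..h} \<subseteq> \<pi> i ` {1..D ! i}" if "i \<in> J" for i
    using assms(3)[OF that] by (intro image_mono) auto
  have "\<pi> i ` {1..D ! i} \<inter> \<pi> j ` {1..D ! j} = {}"
    using assms ij unfolding collision_def disjoint_family_on_def by (meson subsetD)
  with sub[OF ij(1)] sub[OF ij(2)] show "\<pi> i ` {1..h} \<inter> \<pi> j ` {1..h} = {}" by blast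
qed

lemma collision_prob_compl:
  "collision_prob A D
     = 1 - measure_pmf.prob (Pi_pmf {..<length D} id (\<lambda>_. A)) {\<pi>. \<not> collision D \<pi>}"
  using measure_pmf.prob_compl[of "{\<pi>. \<not> collision D \<pi>}" "Pi_pmf {..<length D} id (\<lambda>_. A)"]
  by (simp add: collision_prob_def set_diff_eq)

text \<open>Ignoring instances and later requests can only remove collisions. The instances in J
  form a marginal of the product, which is again a product. The dummy value \<open>f id\<close> is
  the image of the dummy \<open>id\<close>, so that mapping by f commutes with
  \<open>Pi_pmf\<close>.\<close>

lemma prob_no_collision_le:
  assumes "J \<subseteq> {..<length D}" "\<And>i. i \<in> J \<Longrightarrow> h \<le> D ! i"
  defines "f \<equiv> \<lambda>\<pi>. \<pi> ` {1..h}"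
  shows "measure_pmf.prob (Pi_pmf {..<length D} id (\<lambda>_. A)) {\<pi>. \<not> collision D \<pi>}
       \<le> measure_pmf.prob (Pi_pmf J (f id) (\<lambda>_. map_pmf f A)) {F. disjoint_family_on F J}"
proof -
  have "finite J" using assms(1) finite_subset by blast
  then have "Pi_pmf J (f id) (\<lambda>_. map_pmf f A)
      = map_pmf (\<lambda>\<pi>. f \<circ> \<pi>) (map_pmf (\<lambda>\<pi> i. if i \<in> J then \<pi> i else id) (Pi_pmf {..<length D} id (\<lambda>_. A)))"
    using assms(1) by (simp add: Pi_pmf_map[where dflt = id] Pi_pmf_subset[symmetric])
  then have "measure_pmf.prob (Pi_pmf J (f id) (\<lambda>_. map_pmf f A)) {F. disjoint_family_on F J}
      = measure_pmf.prob (Pi_pmf {..<length D} id (\<lambda>_. A))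
          {\<pi>. disjoint_family_on (\<lambda>i. f (if i \<in> J then \<pi> i else id)) J}"
    by (simp add: vimage_def o_def)
  moreover have "disjoint_family_on (\<lambda>i. f (if i \<in> J then \<pi> i else id)) J"
    if "\<not> collision D \<pi>" for \<pi>
    using no_collision_disjoint[OF that assms(1,2)] by (simp add: f_def disjoint_family_on_def)
  ultimately show ?thesis
    by (auto intro!: measure_pmf.finite_measure_mono)
qed

text \<open>The first h IDs of the instances in J are independent random h-subsets of {1..m}.
  Splitting J into two nearly equal halves, one revealed before the other, makes the exponent of
  order \<open>(card J)^2 * h / m\<close> until it saturates.\<close>

lemma collision_prob_ge:
  assumes A: "A \<in> id_algorithms m"
    and J: "J \<subseteq> {..<length D}" "card J \<ge> 2" "\<And>i. i \<in> J \<Longrightarrow> h \<le> D ! i"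
    and h: "1 \<le> h" "h \<le> m"
  shows "collision_prob A D \<ge> min 1 (real (card J) ^ 2 * real h / real m) / 32"
proof -
  define P where "P = map_pmf (\<lambda>\<pi>. \<pi> ` {1..h}) A"
  define q where "q = real h / real m"
  define k where "k = card J"
  have m: "m > 0" using h by simp
  have q0: "q > 0" using h by (simp add: q_def)
  have finJ: "finite J" using J(1) finite_subset by blast
  obtain I where I: "I \<subseteq> J" "card I = k div 2"
    using obtain_subset_with_card_n[of "k div 2" J] by (auto simp: k_def)
  have finI: "finite I" using I(1) finJ finite_subset by blast
  have cardJI: "card (J - I) = k - k div 2"
    using I finI by (simp add: card_Diff_subset k_def)
  define a where "a = real (k div 2)"
  define b where "b = real (k - k div 2)"
  define \<beta> where "\<beta> = min b (1 / q)"
  have a1: "a \<ge> 1" using J(2) by (simp add: a_def k_def)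
  have ab: "a * b \<ge> real k ^ 2 / 6"
  proof -
    \<comment> \<open>The worst case of rounding down is k = 3. The other half rounds up, so the
      product loses a factor 6 altogether.\<close>
    have "k \<le> 3 * (k div 2)" using J(2) unfolding k_def by presburger
    then have "a \<ge> real k / 3" unfolding a_def by linarith
    moreover have "b \<ge> real k / 2" unfolding b_def by linarith
    ultimately have "a * b \<ge> (real k / 3) * (real k / 2)" by (intro mult_mono) (auto simp: b_def)
    then show ?thesis by (simp add: power2_eq_square)
  qed
  define y where "y = 3 / 8 * min 1 (a * b * q)"
  have y: "0 \<le> y" "y \<le> 1" using a1 q0 by (auto simp: y_def b_def)
  have yle: "y \<le> 3 / 8 * a * \<beta> * q"
  proof -
    have "\<beta> * q = min (b * q) 1"
      using q0 by (auto simp: \<beta>_def min_def field_simps)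
    \<comment> \<open>Capping \<open>b * q\<close> at 1 is harmless under the minimum with 1, since
      \<open>a\<close> is at least 1.\<close>
    then have "min 1 (a * b * q) \<le> a * (\<beta> * q)"
      using a1 mult_mono[of 1 a 1 "b * q"] by (auto simp: min_def)
    then show ?thesis by (simp add: y_def)
  qed
  have supp: "S \<subseteq> {1..m} \<and> card S = h" if S: "S \<in> set_pmf P" for S
  proof -
    from S obtain \<pi> where \<pi>: "\<pi> \<in> set_pmf A" "S = \<pi> ` {1..h}" by (auto simp: P_def)
    then have perm: "\<pi> permutes {1..m}" using A by (auto simp: id_algorithms_def)
    then have "S \<subseteq> \<pi> ` {1..m}" using \<pi>(2) h by auto
    then have "S \<subseteq> {1..m}" using permutes_image[OF perm] by simp
    moreover have "card S = h"
      using \<pi>(2) permutes_inj_on[OF perm] by (simp add: card_image)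
    ultimately show ?thesis by simp
  qed
  have "measure_pmf.prob (Pi_pmf {..<length D} id (\<lambda>_. A)) {\<pi>. \<not> collision D \<pi>}
      \<le> measure_pmf.prob (Pi_pmf (I \<union> (J - I)) (id ` {1..h}) (\<lambda>_. P))
           {F. disjoint_family_on F (I \<union> (J - I))}"
    using prob_no_collision_le[OF J(1,3), of A] I(1) by (simp add: P_def Un_absorb1)
  also have "\<dots> \<le> exp (- 3 / 8 * real (card I) * \<beta> * q)"
  proof (rule prob_disjoint_family_le[where M = "{1..m}" and h = h])
    show "\<beta> * q \<le> 1" using q0 by (simp add: \<beta>_def min_def field_simps)
  qed (use supp h m q0 finI finJ cardJI in \<open>auto simp: q_def \<beta>_def b_def\<close>)
  also have "\<dots> \<le> exp (- y)"
    using yle I(2) by (simp add: a_def)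
  also have "\<dots> \<le> 1 - y / 2"
    using y by (rule exp_minus_le_linear)
  finally have "collision_prob A D \<ge> y / 2"
    unfolding collision_prob_compl by linarith
  \<comment> \<open>The constant is 1 / 32 = 3 / 8 * 1 / 2 * 1 / 6.\<close>
  moreover have "min 1 (real k ^ 2 * q) / 32 \<le> y / 2"
  proof -
    have "real k ^ 2 * q / 6 \<le> a * b * q"
      using mult_right_mono[OF ab, of q] q0 by simp
    then show ?thesis by (auto simp: y_def min_def)
  qed
  ultimately show ?thesis by (simp add: k_def q_def)
qed

text \<open>Pigeonhole: disjoint outputs would be \<open>sum_list D\<close> distinct elements of
  {1..m}. This settles the case d > m, where the bound m on the entries need not follow from their
  sum.\<close>

lemma collision_prob_eq_1:
  assumes A: "A \<in> id_algorithms m" and D: "set D \<subseteq> {1..m}" and d: "sum_list D > m"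
  shows "collision_prob A D = 1"
  unfolding collision_prob_def
proof (subst measure_pmf.prob_eq_1)
  show "AE \<pi> in Pi_pmf {..<length D} id (\<lambda>_. A). \<pi> \<in> {\<pi>. collision D \<pi>}"
  proof (unfold AE_measure_pmf_iff, intro ballI CollectI)
    fix \<pi> assume "\<pi> \<in> set_pmf (Pi_pmf {..<length D} id (\<lambda>_. A))"
    then have perm: "\<pi> i permutes {1..m}" if "i < length D" for i
      using that A by (auto simp: set_Pi_pmf PiE_dflt_def id_algorithms_def)
    show "collision D \<pi>"
    proof (rule ccontr)
      assume "\<not> collision D \<pi>"
      then have disj: "disjoint_family_on (\<lambda>i. \<pi> i ` {1..D ! i}) {..<length D}"
        by (simp add: collision_def)
      have "\<pi> i ` {1..D ! i} \<subseteq> {1..m}" if "i < length D" for i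
      proof -
        have "D ! i \<le> m" using D that nth_mem[of i D] by fastforce
        then have "\<pi> i ` {1..D ! i} \<subseteq> \<pi> i ` {1..m}" by (intro image_mono) auto
        then show ?thesis using permutes_image[OF perm[OF that]] by simp
      qed
      then have "card (\<Union>i\<in>{..<length D}. \<pi> i ` {1..D ! i}) \<le> card {1..m}"
        by (intro card_mono) auto
      moreover have "card (\<Union>i\<in>{..<length D}. \<pi> i ` {1..D ! i}) = (\<Sum>i<length D. card (\<pi> i ` {1..D ! i}))"
        using disj by (intro card_UN_disjoint) (auto simp: disjoint_family_on_def)
      moreover have "\<dots> = (\<Sum>i<length D. D ! i)"
        using permutes_inj_on[OF perm] by (intro sum.cong) (auto simp: card_image)
      moreover have "\<dots> = sum_list D"
        by (simp add: sum_list_sum_nth atLeast0LessThan)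
      ultimately show False using d by simp
    qed
  qed
qed simp

subsection \<open>Compositions with many small parts\<close>

lemma nths_pair_inj:
  assumes "length xs = length ys" "nths xs T = nths ys T" "nths xs (- T) = nths ys (- T)"
  shows "xs = ys"
  using assms
proof (induction xs ys arbitrary: T rule: list_induct2)
  case (Cons x xs y ys)
  have *: "- {j. Suc j \<in> T} = {j. Suc j \<notin> T}" by auto
  show ?case
    using Cons.prems Cons.IH[of "{j. Suc j \<in> T}"]
    by (cases "0 \<in> T") (auto simp: nths_Cons *)
qed simp

lemma sum_list_nths_split:
  "sum_list (nths xs T) + sum_list (nths xs (- T)) = (sum_list xs :: nat)"
proof (induction xs arbitrary: T)
  case (Cons x xs)
  have *: "- {j. Suc j \<in> T} = {j. Suc j \<notin> T}" by auto
  show ?case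
    using Cons.IH[of "{j. Suc j \<in> T}"] by (auto simp: nths_Cons *)
qed simp

text \<open>Demand profiles without the upper bound m on entries. For d \<le> m that bound is
  automatic, so the counting can proceed independently of m.\<close>

definition compositions :: "nat \<Rightarrow> nat \<Rightarrow> nat list set" where
  "compositions n d = {D. length D = n \<and> 0 \<notin> set D \<and> sum_list D = d}"

lemma compositions_nth_pos:
  assumes "D \<in> compositions n d" "i < n"
  shows "D ! i > 0"
  using assms nth_mem[of i D] unfolding compositions_def
  by (metis (mono_tags, lifting) gr0I mem_Collect_eq)

lemma finite_compositions: "finite (compositions n d)"
proof (rule finite_subset)
  show "compositions n d \<subseteq> {D. set D \<subseteq> {..d} \<and> length D = n}"
    by (auto simp: compositions_def member_le_sum_list)
qed (simp add: finite_lists_length_eq)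

text \<open>Stars and bars, after subtracting 1 from every part.\<close>

lemma card_compositions:
  assumes "n \<ge> 1" "d \<ge> n"
  shows "card (compositions n d) = (d - 1) choose (n - 1)"
proof -
  have "bij_betw (map Suc) {l::nat list. length l = n \<and> sum_list l = d - n} (compositions n d)"
  proof (intro bij_betwI[where g = "map (\<lambda>x. x - 1)"])
    have sum_Suc: "sum_list (map Suc l) = sum_list l + length l" for l
      by (induction l) auto
    show "map Suc \<in> {l. length l = n \<and> sum_list l = d - n} \<rightarrow> compositions n d"
      using assms by (auto simp: compositions_def sum_Suc)
    have inv: "map Suc (map (\<lambda>x. x - 1) l) = l" if "0 \<notin> set l" for l
      using that by (induction l) auto
    then show "map Suc (map (\<lambda>x. x - 1) l) = l" if "l \<in> compositions n d" for l
      using that by (auto simp: compositions_def)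
    show "map (\<lambda>x. x - 1) \<in> compositions n d \<rightarrow> {l. length l = n \<and> sum_list l = d - n}"
    proof
      fix l assume l: "l \<in> compositions n d"
      have "sum_list l = sum_list (map (\<lambda>x. x - 1) l) + n"
        using sum_Suc[of "map (\<lambda>x. x - 1) l"] inv[of l] l by (simp add: compositions_def)
      then show "map (\<lambda>x. x - 1) l \<in> {l. length l = n \<and> sum_list l = d - n}"
        using l by (auto simp: compositions_def)
    qed
  qed (simp add: o_def)
  then have "card (compositions n d) = card {l::nat list. length l = n \<and> sum_list l = d - n}"
    by (simp add: bij_betw_same_card)
  also have "\<dots> = (d - 1) choose (d - n)"
    using assms by (simp add: card_length_sum_list)
  also have "\<dots> = (d - 1) choose (n - 1)"
    using assms binomial_symmetric[of "n - 1" "d - 1"] by simp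
  finally show ?thesis .
qed

lemma binomial_mono_left: "N \<le> N' \<Longrightarrow> N choose k \<le> N' choose k"
  by (rule lift_Suc_mono_le[of "\<lambda>N. N choose k"]) (cases k; simp)+

text \<open>A bound uniform in d', so that the sum of the entries split off in the next count can be
  forgotten.\<close>

lemma card_compositions_le:
  assumes "n \<ge> 1" "d' \<le> d"
  shows "card (compositions n d') \<le> (d - 1) choose (n - 1)"
proof (cases "d' \<ge> n")
  case True
  then show ?thesis
    using assms binomial_mono_left[of "d' - 1" "d - 1" "n - 1"] by (simp add: card_compositions)
next
  case False
  have "length D \<le> sum_list D" if "0 \<notin> set D" for D
    using that by (induction D) auto
  then have "compositions n d' = {}"
    using False by (force simp: compositions_def)
  then show ?thesis by simp
qed

text \<open>
  Splitting off the entries at the positions \<open>T\<close> leaves a composition of a smaller number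
  into \<open>n - card T\<close> parts.
\<close>

lemma card_compositions_small_on_le:
  assumes "T \<subseteq> {..<n}" "card T < n"
  shows "card {D \<in> compositions n d. \<forall>i\<in>T. D ! i \<le> k}
           \<le> k ^ card T * ((d - 1) choose (n - card T - 1))"
proof -
  let ?t = "card T"
  let ?C = "{D \<in> compositions n d. \<forall>i\<in>T. D ! i \<le> k}"
  let ?L = "{s. set s \<subseteq> {1..k} \<and> length s = ?t}"
  let ?B = "SIGMA s:?L. compositions (n - ?t) (d - sum_list s)"
  have finT: "finite T" using assms(1) finite_subset by blast
  have finL: "finite ?L" by (simp add: finite_lists_length_eq)
  have "card ?C \<le> card ?B"
  proof (rule card_inj_on_le[where f = "\<lambda>D. (nths D T, nths D (- T))"])
    show "inj_on (\<lambda>D. (nths D T, nths D (- T))) ?C"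
      by (intro inj_onI) (auto simp: compositions_def intro: nths_pair_inj)
    show "(\<lambda>D. (nths D T, nths D (- T))) ` ?C \<subseteq> ?B"
    proof safe
      fix D assume D: "D \<in> compositions n d" and small: "\<forall>i\<in>T. D ! i \<le> k"
      have len: "length D = n" using D by (simp add: compositions_def)
      have "{i. i < n \<and> i \<in> T} = T" using assms(1) by auto
      then show "length (nths D T) = ?t" by (simp add: length_nths len)
      have "{i. i < n \<and> i \<in> - T} = {..<n} - T" by auto
      then have len': "length (nths D (- T)) = n - ?t"
        using assms(1) finT by (simp add: length_nths len card_Diff_subset)
      show "x \<in> {1..k}" if "x \<in> set (nths D T)" for x
        using that small compositions_nth_pos[OF D] by (auto simp: set_nths len Suc_le_eq)
      have "0 \<notin> set (nths D (- T))"
        using D by (simp add: compositions_def)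
      then show "nths D (- T) \<in> compositions (n - ?t) (d - sum_list (nths D T))"
        using len' D sum_list_nths_split[of D T] by (auto simp: compositions_def)
    qed
    show "finite ?B"
      using finL finite_compositions by (intro finite_SigmaI) auto
  qed
  also have "\<dots> = (\<Sum>s\<in>?L. card (compositions (n - ?t) (d - sum_list s)))"
    using finL finite_compositions by (intro card_SigmaI) auto
  \<comment> \<open>At least one part remains because \<open>card T < n\<close>, and the bound no
    longer depends on s.\<close>
  also have "\<dots> \<le> (\<Sum>s\<in>?L. (d - 1) choose (n - ?t - 1))"
    using assms by (intro sum_mono card_compositions_le) auto
  also have "\<dots> = k ^ ?t * ((d - 1) choose (n - ?t - 1))"
    by (simp add: card_lists_length_eq)
  finally show ?thesis .
qed

text \<open>For r < k, passing from N choose r to N choose (r + 1) multiplies by (N - r) / (r + 1),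
  which is at least (N - k) / k. The claim is t such steps, stated without division.\<close>

lemma binomial_diff_power_le:
  assumes "t \<le> k" "k \<le> N"
  shows "(N choose (k - t)) * (N - k) ^ t \<le> (N choose k) * k ^ t"
  using assms(1)
proof (induction t)
  case (Suc t)
  define r where "r = k - Suc t"
  have r: "k - t = Suc r" using Suc.prems by (simp add: r_def)
  have step: "(N choose r) * (N - r) = (N choose Suc r) * Suc r"
    using binomial_absorb_comp[of N r] binomial_absorption[of r N]
    by (metis mult.commute)
  have "(N choose r) * (N - k) ^ Suc t \<le> (N choose r) * (N - r) * (N - k) ^ t"
  proof -
    have "N - k \<le> N - r" using Suc.prems by (simp add: r_def)
    then have "(N choose r) * (N - k) ^ t * (N - k) \<le> (N choose r) * (N - k) ^ t * (N - r)"
      by (intro mult_left_mono) auto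
    then show ?thesis by (simp add: algebra_simps)
  qed
  also have "\<dots> = Suc r * ((N choose (k - t)) * (N - k) ^ t)"
    unfolding step r by (simp add: algebra_simps)
  also have "\<dots> \<le> k * ((N choose k) * k ^ t)"
    by (rule mult_le_mono) (use Suc in \<open>auto simp: r_def\<close>)
  finally show ?case by (simp add: r_def algebra_simps)
qed simp

text \<open>A union bound over the sets T of t = (n + 1) div 2 positions with small entries. For d
  \<ge> 2 * n, d - n is at least half of d, which halves 32 to 16: each position of T costs a factor
  of at least 16. As 16^t \<ge> 4^n, a factor 2^n is left after paying for the at most 2^n sets
  T.\<close>

lemma card_compositions_many_small_le:
  assumes n: "n \<ge> 2" and k: "k * (32 * n) \<le> d - 1"
  shows "card {D \<in> compositions n d. 2 * card {i. i < n \<and> D ! i \<le> k} \<ge> n} * 2 ^ n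
           \<le> card (compositions n d)"
proof (cases "d < 2 * n")
  case True
  \<comment> \<open>For such small d the threshold k is 0, and no part of a composition is that
    small.\<close>
  with k have "k * (32 * n) < 1 * (32 * n)" by linarith
  then have "k = 0" by simp
  then have none: "{i. i < n \<and> D ! i \<le> k} = {}" if "D \<in> compositions n d" for D
    using compositions_nth_pos[OF that] by auto
  have "{D \<in> compositions n d. 2 * card {i. i < n \<and> D ! i \<le> k} \<ge> n} = {}"
    using n by (simp add: none cong: conj_cong)
  then show ?thesis by (simp only: card.empty mult_0 le0)
next
  case False
  then have d: "d \<ge> 2 * n" by simp
  define t where "t = (n + 1) div 2"
  have t: "t < n" "n \<le> 2 * t" using n by (auto simp: t_def)
  let ?Ts = "{T. T \<subseteq> {..<n} \<and> card T = t}"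
  let ?bad = "{D \<in> compositions n d. 2 * card {i. i < n \<and> D ! i \<le> k} \<ge> n}"
  have "?bad \<subseteq> (\<Union>T\<in>?Ts. {D \<in> compositions n d. \<forall>i\<in>T. D ! i \<le> k})"
  proof
    fix D assume D: "D \<in> ?bad"
    then have "t \<le> card {i. i < n \<and> D ! i \<le> k}" by (auto simp: t_def)
    then obtain T where "T \<subseteq> {i. i < n \<and> D ! i \<le> k}" "card T = t"
      by (rule obtain_subset_with_card_n)
    then show "D \<in> (\<Union>T\<in>?Ts. {D \<in> compositions n d. \<forall>i\<in>T. D ! i \<le> k})"
      using D by auto
  qed
  then have "card ?bad \<le> card (\<Union>T\<in>?Ts. {D \<in> compositions n d. \<forall>i\<in>T. D ! i \<le> k})"
    by (intro card_mono) (auto simp: finite_compositions)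
  also have "\<dots> \<le> (\<Sum>T\<in>?Ts. card {D \<in> compositions n d. \<forall>i\<in>T. D ! i \<le> k})"
    by (intro card_UN_le) auto
  also have "\<dots> \<le> (\<Sum>T\<in>?Ts. k ^ t * ((d - 1) choose (n - 1 - t)))"
  proof (intro sum_mono)
    fix T assume "T \<in> ?Ts"
    then show "card {D \<in> compositions n d. \<forall>i\<in>T. D ! i \<le> k} \<le> k ^ t * ((d - 1) choose (n - 1 - t))"
      using card_compositions_small_on_le[of T n d k] t by (simp add: diff_right_commute)
  qed
  also have "\<dots> = (n choose t) * (k ^ t * ((d - 1) choose (n - 1 - t)))"
    by (simp add: n_subsets)
  also have "\<dots> \<le> 2 ^ n * (k ^ t * ((d - 1) choose (n - 1 - t)))"
    by (intro mult_right_mono binomial_le_pow2) auto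
  finally have bad: "card ?bad \<le> 2 ^ n * (k ^ t * ((d - 1) choose (n - 1 - t)))" .
  have k': "k * 16 * n \<le> d - n" using k d by linarith
  \<comment> \<open>The factor \<open>n ^ t\<close> is carried along and cancelled at the end, which
    keeps the estimate in the natural numbers.\<close>
  have "(16 ^ t * (k ^ t * ((d - 1) choose (n - 1 - t)))) * n ^ t
      = ((d - 1) choose (n - 1 - t)) * (k * 16 * n) ^ t"
    by (simp add: power_mult_distrib)
  also have "\<dots> \<le> ((d - 1) choose (n - 1 - t)) * (d - n) ^ t"
    using k' by (intro mult_left_mono power_mono) auto
  also have "\<dots> \<le> ((d - 1) choose (n - 1)) * (n - 1) ^ t"
    using binomial_diff_power_le[of t "n - 1" "d - 1"] t d n by simp
  also have "\<dots> \<le> ((d - 1) choose (n - 1)) * n ^ t"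
    by (intro mult_left_mono power_mono) auto
  finally have main: "16 ^ t * (k ^ t * ((d - 1) choose (n - 1 - t))) \<le> (d - 1) choose (n - 1)"
    using n by simp
  have "card ?bad * 2 ^ n \<le> 2 ^ n * (k ^ t * ((d - 1) choose (n - 1 - t))) * 2 ^ n"
    using bad by (intro mult_right_mono) auto
  also have "\<dots> = 2 ^ (2 * n) * (k ^ t * ((d - 1) choose (n - 1 - t)))"
    by (simp add: mult_2 power_add)
  also have "\<dots> \<le> 2 ^ (4 * t) * (k ^ t * ((d - 1) choose (n - 1 - t)))"
    using t by (intro mult_right_mono power_increasing) auto
  also have "\<dots> = 16 ^ t * (k ^ t * ((d - 1) choose (n - 1 - t)))"
    by (simp add: power_mult)
  also have "\<dots> \<le> card (compositions n d)"
    using main d n by (simp add: card_compositions)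
  finally show ?thesis .
qed

subsection \<open>Typical demand profiles\<close>

lemma opt_collision_prob_geI:
  assumes "\<And>A. A \<in> id_algorithms m \<Longrightarrow> x \<le> collision_prob A D"
  shows "x \<le> opt_collision_prob m D"
  unfolding opt_collision_prob_def
proof (rule cINF_greatest)
  have "return_pmf id \<in> id_algorithms m"
    by (simp add: id_algorithms_def permutes_id)
  then show "id_algorithms m \<noteq> {}" by blast
qed (fact assms)

lemma demand_profiles_eq_compositions:
  assumes "d \<le> m"
  shows "demand_profiles m n d = compositions n d"
proof -
  have "set D \<subseteq> {1..m} \<longleftrightarrow> 0 \<notin> set D" if "sum_list D = d" for D
  proof
    assume nz: "0 \<notin> set D"
    show "set D \<subseteq> {1..m}"
    proof
      fix x assume x: "x \<in> set D"
      then have "x \<le> m" using member_le_sum_list[of x D] that assms by linarith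
      moreover have "x \<noteq> 0" using x nz by metis
      ultimately show "x \<in> {1..m}" by simp
    qed
  qed auto
  then show ?thesis
    unfolding demand_profiles_def compositions_def by blast
qed

lemma opt_collision_prob_few_small:
  assumes D: "length D = n" "set D \<subseteq> {1..m}" and n: "n \<ge> 2" and d: "d \<le> 32 * n * (k + 1)"
    and few: "2 * card {i. i < n \<and> D ! i \<le> k} < n"
  shows "opt_collision_prob m D \<ge> 1 / 4096 * min 1 (real n * real d / real m)"
proof (rule opt_collision_prob_geI)
  fix A assume A: "A \<in> id_algorithms m"
  \<comment> \<open>More than half of the instances receive at least h = k + 1 requests. Any one of
    them also shows that h \<le> m.\<close>
  define J where "J = {..<n} - {i. i < n \<and> D ! i \<le> k}"
  have "card J = n - card {i. i < n \<and> D ! i \<le> k}"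
    unfolding J_def by (subst card_Diff_subset) auto
  then have card_J: "n < 2 * card J" using few by linarith
  have big: "k + 1 \<le> D ! i" if "i \<in> J" for i using that by (auto simp: J_def)
  have "J \<noteq> {}" using card_J by auto
  then obtain i where i: "i \<in> J" by blast
  then have "D ! i \<in> set D" using D(1) by (simp add: J_def)
  then have hm: "k + 1 \<le> m" using D(2) big[OF i] by auto
  have "real d \<le> real (32 * n * (k + 1))"
    using d by (simp only: of_nat_le_iff)
  then have "real n * real d \<le> real n * (32 * real n * real (k + 1))"
    by (intro mult_left_mono) (simp_all add: algebra_simps)
  also have "\<dots> = 32 * (real n)\<^sup>2 * real (k + 1)"
    by (simp add: power2_eq_square)
  also have "\<dots> \<le> 32 * (2 * real (card J))\<^sup>2 * real (k + 1)"
    using card_J by (intro mult_right_mono mult_left_mono power_mono) auto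
  also have "\<dots> = 128 * ((real (card J))\<^sup>2 * real (k + 1))"
    by (simp add: power_mult_distrib)
  finally have "real n * real d / real m \<le> 128 * ((real (card J))\<^sup>2 * real (k + 1)) / real m"
    by (rule divide_right_mono) simp
  also have "\<dots> = 128 * ((real (card J))\<^sup>2 * real (k + 1) / real m)"
    by (rule times_divide_eq_right[symmetric])
  finally have le: "real n * real d / real m \<le> 128 * ((real (card J))\<^sup>2 * real (k + 1) / real m)" .
  \<comment> \<open>Here 4096 = 32 * 128: the factor 128 is 32 from d \<le> 32 * n * (k + 1) times 4
    from n < 2 * card J.\<close>
  have "1 / 4096 * min 1 u \<le> min 1 v / 32" if "u \<le> 128 * v" for u v :: real
    using that by (auto simp: min_def)
  from this[OF le] have "1 / 4096 * min 1 (real n * real d / real m)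
      \<le> min 1 ((real (card J))\<^sup>2 * real (k + 1) / real m) / 32" .
  also have "\<dots> \<le> collision_prob A D"
    by (rule collision_prob_ge[OF A]) (use card_J n hm D(1) big in \<open>auto simp: J_def\<close>)
  finally show "1 / 4096 * min 1 (real n * real d / real m) \<le> collision_prob A D" .
qed

theorem theorem3p6:
  "\<exists>c a :: real. c > 0 \<and> a > 0 \<and>
     (\<forall>m n d :: nat. m \<ge> 1 \<longrightarrow> n \<ge> 2 \<longrightarrow>
        real (card {D \<in> demand_profiles m n d.
                      \<not> opt_collision_prob m D \<ge> c * min 1 (real n * real d / real m)})
          \<le> exp (- a * real n) * real (card (demand_profiles m n d)))"
proof (rule exI[of _ "1 / 4096"], rule exI[of _ "ln 2"], intro conjI allI impI)
  fix m n d :: nat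
  assume "m \<ge> 1" and n: "n \<ge> 2"
  let ?bad = "{D \<in> demand_profiles m n d.
                 \<not> opt_collision_prob m D \<ge> 1 / 4096 * min 1 (real n * real d / real m)}"
  show "real (card ?bad) \<le> exp (- ln 2 * real n) * real (card (demand_profiles m n d))"
  proof (cases "d > m")
    case True
    have "1 / 4096 * min 1 (real n * real d / real m) \<le> opt_collision_prob m D"
      if "D \<in> demand_profiles m n d" for D
    proof -
      have "1 \<le> opt_collision_prob m D"
        using that True
        by (intro opt_collision_prob_geI) (simp add: demand_profiles_def collision_prob_eq_1)
      moreover have "1 / 4096 * min 1 (real n * real d / real m) \<le> 1"
        by (simp add: min_def)
      ultimately show ?thesis by (rule order_trans[rotated])
    qed
    then have "?bad = {}" by blast
    then show ?thesis by (simp only: card.empty) simp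
  next
    case False
    \<comment> \<open>The largest threshold that the counting lemma admits. Being largest, it also
      gives d \<le> 32 * n * (k + 1), so h = k + 1 is at least d / (32 * n) even when k = 0.\<close>
    define k where "k = (d - 1) div (32 * n)"
    have k: "k * (32 * n) \<le> d - 1" by (simp add: k_def)
    have "d - 1 < 32 * n * (k + 1)"
      using n dividend_less_times_div[of "32 * n" "d - 1"] by (simp add: k_def)
    then have d: "d \<le> 32 * n * (k + 1)" by linarith
    let ?small = "{D \<in> compositions n d. 2 * card {i. i < n \<and> D ! i \<le> k} \<ge> n}"
    have profiles: "demand_profiles m n d = compositions n d"
      using False by (simp add: demand_profiles_eq_compositions)
    have "?bad \<subseteq> ?small"
    proof
      fix D assume D: "D \<in> ?bad"
      then have "length D = n" "set D \<subseteq> {1..m}" by (auto simp: demand_profiles_def)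
      then have "\<not> 2 * card {i. i < n \<and> D ! i \<le> k} < n"
        using opt_collision_prob_few_small[OF _ _ n d] D by blast
      then show "D \<in> ?small" using D profiles by auto
    qed
    then have "card ?bad \<le> card ?small"
      by (intro card_mono) (auto simp: finite_compositions)
    then have "card ?bad * 2 ^ n \<le> card (compositions n d)"
      using card_compositions_many_small_le[OF n k] mult_le_mono1 order_trans by blast
    then have "real (card ?bad) * 2 ^ n \<le> real (card (compositions n d))"
      by (metis (mono_tags, lifting) of_nat_le_iff of_nat_mult of_nat_numeral of_nat_power)
    then have "real (card ?bad) \<le> 1 / 2 ^ n * real (card (demand_profiles m n d))"
      unfolding profiles by (simp add: pos_le_divide_eq)
    moreover have "exp (- ln 2 * real n) = 1 / 2 ^ n"
      by (simp add: exp_minus exp_of_nat2_mult inverse_eq_divide)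
    ultimately show ?thesis by simp
  qed
qed simp_all

end
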